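(* Let $G=\mathbb{Z}_{n_1}\times\cdots\times\mathbb{Z}_{n_d}$, where $n_1,\ldots,n_d\ge 2$, and let $S$ be an inverse-closed subset of $G\setminus\{(0,\ldots,0)\}$ with $\langle S\rangle=G$. Suppose that $|S|=p$ is an odd prime and that exactly one of $n_1,\ldots,n_d$, say $n_t$, is divisible by $p$. Then $\mathrm{Cay}(G,S)$ admits a total perfect code if and only if $s_t\not\equiv s'_t\pmod p$ for each pair of distinct elements $(s_1,\ldots,s_d),(s'_1,\ldots,s'_d)$ of $S$.
   Context: Inverse-closed means $-S=S$. The Cayley graph $\mathrm{Cay}(G,S)$ has vertex set $G$, with $x,y$ adjacent iff $y-x\in S$. A total perfect code in a graph is a set $C$ of vertices such that every vertex of the graph (including those in $C$) is adjacent to exactly one vertex of $C$. Congruence of elements of $\mathbb{Z}_{n_t}$ modulo $p$ makes sense since $p\mid n_t$. *)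

theory Defs
  imports
    "HOL-Algebra.Product_Groups"
    "HOL-Number_Theory.Cong"
    "Graph_Theory.Graph_Theory"
begin

(* An undirected graph is a symmetric digraph, as usual in Graph_Theory; the lemma
   cayley_graph_pair_graph confirms that for the connection sets considered here we obtain
   a finite simple graph.  Written additively, y \<otimes> inv x is y - x. *)
definition cayley_graph :: "('a, 'b) monoid_scheme \<Rightarrow> 'a set \<Rightarrow> 'a pair_pre_digraph" where
  "cayley_graph G S =
     \<lparr> pverts = carrier G,
       parcs = {(x, y). x \<in> carrier G \<and> y \<in> carrier G \<and> y \<otimes>\<^bsub>G\<^esub> inv\<^bsub>G\<^esub> x \<in> S} \<rparr>"

definition total_perfect_code :: "('a, 'b) pre_digraph \<Rightarrow> 'a set \<Rightarrow> bool" where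
  "total_perfect_code \<Gamma> C \<longleftrightarrow>
     C \<subseteq> verts \<Gamma> \<and> (\<forall>v \<in> verts \<Gamma>. \<exists>!c. c \<in> C \<and> v \<rightarrow>\<^bsub>\<Gamma>\<^esub> c)"

lemma cayley_graph_pair_graph:
  assumes "group G" and "finite (carrier G)"
    and "S \<subseteq> carrier G - {\<one>\<^bsub>G\<^esub>}" and "set_inv\<^bsub>G\<^esub> S = S"
  shows "pair_graph (cayley_graph G S)"
proof -
  interpret group G by fact
  have sym: "x \<otimes>\<^bsub>G\<^esub> inv\<^bsub>G\<^esub> y \<in> S"
    if "x \<in> carrier G" "y \<in> carrier G" "y \<otimes>\<^bsub>G\<^esub> inv\<^bsub>G\<^esub> x \<in> S" for x y
  proof -
    have "inv\<^bsub>G\<^esub> (y \<otimes>\<^bsub>G\<^esub> inv\<^bsub>G\<^esub> x) \<in> S"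
      using that assms(4) unfolding SET_INV_def by blast
    then show ?thesis using that by (simp add: inv_mult_group)
  qed
  have "parcs (cayley_graph G S) \<subseteq> carrier G \<times> carrier G"
    by (auto simp: cayley_graph_def)
  then have fin: "finite (parcs (cayley_graph G S))"
    using assms(2) by (meson finite_SigmaI finite_subset)
  show ?thesis
    using assms(2,3) sym fin
    by unfold_locales
      (auto simp: cayley_graph_def symmetric_def arcs_ends_def arc_to_ends_def sym_def)
qed

end

theory Submission
  imports Defs "HOL-Library.Indicator_Function"
begin

text \<open>
  A total perfect code of the Cayley graph is a set \<open>C\<close> such that every \<open>v\<close> has exactly one
  \<open>s \<in> S\<close> with \<open>v + s \<in> C\<close>; in other words, the sets \<open>C - s\<close> tile \<open>G\<close>.  If the residues
  \<open>s\<^sub>t\<close> modulo \<open>p\<close> are distinct, they are all the residues because \<open>|S| = p\<close>, and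
  \<open>C = {c. p dvd c\<^sub>t}\<close> is a code.  The substance is the converse.

  Let \<open>f\<close> be the indicator function of a code \<open>C\<close> and \<open>T\<close> the operator
  \<open>(T f) g = (\<Sum>s\<in>S. f (g + s))\<close>, so that \<open>T f = 1\<close> and \<open>T\<^sup>m f = p ^ (m - 1)\<close> for \<open>m > 0\<close>.  As \<open>T\<close> is a sum of
  commuting translations, the Frobenius congruence gives, for each prime \<open>q\<close>,
  \<open>(T\<^sup>q f) g \<equiv> (\<Sum>s\<in>S. f (g + q s))\<close> modulo \<open>q\<close> (\<open>translate_sum_funpow_prime_cong\<close>).  This is
  used for two primes.

  For \<open>q = 2\<close>, the number of \<open>s \<in> S\<close> with \<open>g + 2 s \<in> C\<close> is odd, as \<open>p\<close> is.  It is therefore at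
  least one for every \<open>g\<close>, and its average over \<open>G\<close> is \<open>|S| |C| / |G| = 1\<close>, so it is always one:
  the doubled set \<open>2 S\<close> gives a tiling with the same \<open>C\<close> (\<open>tiling_sum_squares\<close>).

  For \<open>q = p\<close>, the number of \<open>s \<in> S\<close> with \<open>g + p s \<in> C\<close> is divisible by \<open>p = |S|\<close>, so it is zero or
  \<open>p\<close>: whether \<open>g + p s \<in> C\<close> does not depend on \<open>s\<close>.  Comparing \<open>s\<close> with \<open>- s\<close> shows that \<open>2 p s\<close> is
  a period of \<open>C\<close>, and since \<open>S\<close> generates \<open>G\<close>, all of \<open>2 p G\<close> consists of periods
  (\<open>tiling_periodic\<close>).

  Now let \<open>s, s' \<in> S\<close> have congruent coordinates at \<open>t\<close>.  Modulo every other \<open>n\<^sub>i\<close> the prime \<open>p\<close> is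
  invertible, so \<open>s - s' = p x\<close> for some \<open>x \<in> G\<close> (\<open>product_integer_mod_power_diff\<close>).  Then
  \<open>2 s - 2 s' = 2 p x\<close> is a period of \<open>C\<close>, so \<open>s\<close> and \<open>s'\<close> count for the same \<open>g\<close> in the tiling by
  \<open>2 S\<close>; hence \<open>s = s'\<close> (\<open>tiling_distinct_mod_powers\<close>).
\<close>

section \<open>Summing over translates\<close>

definition translate_sum :: "('a, 'b) monoid_scheme \<Rightarrow> 'a set \<Rightarrow> ('a \<Rightarrow> int) \<Rightarrow> 'a \<Rightarrow> int" where
  "translate_sum G S f = (\<lambda>g. \<Sum>s\<in>S. f (g \<otimes>\<^bsub>G\<^esub> s))"

context comm_group
begin

text \<open>The binomial theorem for the sum of the operator for \<open>S\<close> and the translation by \<open>a\<close>, which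
  commute because the group does.\<close>

lemma translate_sum_insert_funpow:
  assumes "finite S" and "S \<subseteq> carrier G" and "a \<in> carrier G" and "a \<notin> S" and "g \<in> carrier G"
  shows "(translate_sum G (insert a S) ^^ m) f g =
           (\<Sum>k\<le>m. int (m choose k) * (translate_sum G S ^^ k) f (g \<otimes> a [^] (m - k)))"
  using \<open>g \<in> carrier G\<close>
proof (induction m arbitrary: g)
  case 0
  then show ?case by simp
next
  case (Suc m)
  define F where "F = (translate_sum G (insert a S) ^^ m) f"
  define X where "X k j = (translate_sum G S ^^ k) f (g \<otimes> a [^] (j::nat))" for k j
  have IH: "F h = (\<Sum>k\<le>m. int (m choose k) * (translate_sum G S ^^ k) f (h \<otimes> a [^] (m - k)))"
    if "h \<in> carrier G" for h
    using Suc.IH[OF that] by (simp add: F_def)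
  have a_term: "F (g \<otimes> a) = X 0 (Suc m) + (\<Sum>k\<le>m. int (m choose Suc k) * X (Suc k) (m - k))"
  proof -
    have "F (g \<otimes> a) = (\<Sum>k\<le>m. int (m choose k) * X k (Suc m - k))"
      unfolding IH[OF m_closed[OF \<open>g \<in> carrier G\<close> \<open>a \<in> carrier G\<close>]] X_def
      using Suc.prems assms(3)
      by (intro sum.cong refl) (simp add: m_ac Suc_diff_le)
    \<comment> \<open>The new summand vanishes; it makes the shift of the index below match Pascal's rule.\<close>
    also have "\<dots> = (\<Sum>k\<le>Suc m. int (m choose k) * X k (Suc m - k))"
      by simp
    finally show ?thesis
      unfolding sum.atMost_Suc_shift by simp
  qed
  have "(\<Sum>s\<in>S. F (g \<otimes> s)) =
      (\<Sum>s\<in>S. \<Sum>k\<le>m. int (m choose k) *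
        (translate_sum G S ^^ k) f (g \<otimes> a [^] (m - k) \<otimes> s))"
  proof (intro sum.cong refl)
    fix s assume "s \<in> S"
    then have s: "s \<in> carrier G" using assms(2) by blast
    have "g \<otimes> s \<otimes> a [^] k = g \<otimes> a [^] k \<otimes> s" for k :: nat
      using s Suc.prems assms(3) by (simp add: m_ac)
    then show "F (g \<otimes> s) = (\<Sum>k\<le>m. int (m choose k) *
        (translate_sum G S ^^ k) f (g \<otimes> a [^] (m - k) \<otimes> s))"
      using IH[of "g \<otimes> s"] s Suc.prems by simp
  qed
  also have "\<dots> = (\<Sum>k\<le>m. int (m choose k) * X (Suc k) (m - k))"
    by (subst sum.swap) (simp add: X_def translate_sum_def sum_distrib_left)
  finally have S_terms: "(\<Sum>s\<in>S. F (g \<otimes> s)) = (\<Sum>k\<le>m. int (m choose k) * X (Suc k) (m - k))" .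
  have "(translate_sum G (insert a S) ^^ Suc m) f g = F (g \<otimes> a) + (\<Sum>s\<in>S. F (g \<otimes> s))"
    using assms(1,4) by (simp add: F_def translate_sum_def)
  also have "\<dots> = X 0 (Suc m) + (\<Sum>k\<le>m. int (Suc m choose Suc k) * X (Suc k) (m - k))"
    unfolding a_term S_terms by (simp add: distrib_right sum.distrib)
  also have "\<dots> = (\<Sum>k\<le>Suc m. int (Suc m choose k) * X k (Suc m - k))"
    unfolding sum.atMost_Suc_shift by simp
  finally show ?case by (simp add: X_def)
qed

text \<open>Frobenius: all binomial coefficients but the first and last are divisible by the prime \<open>q\<close>, so
  the elements of \<open>S\<close> can be split off one by one.\<close>

lemma translate_sum_funpow_prime_cong:
  assumes "prime q" and "finite S" and "S \<subseteq> carrier G" and "g \<in> carrier G"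
  shows "[(translate_sum G S ^^ q) f g = (\<Sum>s\<in>S. f (g \<otimes> s [^] q))] (mod int q)"
  using assms(2-4)
proof (induction S arbitrary: g rule: finite_induct)
  case empty
  obtain k where "q = Suc k"
    using \<open>prime q\<close> by (metis not_prime_0 old.nat.exhaust)
  then show ?case by (simp add: translate_sum_def)
next
  case (insert a S)
  define Y where "Y k = int (q choose k) * (translate_sum G S ^^ k) f (g \<otimes> a [^] (q - k))" for k
  have q: "q > 0" using \<open>prime q\<close> by (rule prime_gt_0_nat)
  have "(translate_sum G (insert a S) ^^ q) f g = (\<Sum>k\<le>q. Y k)"
    unfolding Y_def using insert by (intro translate_sum_insert_funpow) auto
  also have "\<dots> = Y 0 + Y q + (\<Sum>k\<in>{..q} - {0, q}. Y k)"
    using q by (subst sum.subset_diff[of "{0, q}"]) auto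
  also have "[\<dots> = Y 0 + Y q + 0] (mod int q)"
  proof (intro cong_add cong_refl)
    have "int q dvd Y k" if "k \<in> {..q} - {0, q}" for k
      unfolding Y_def using that \<open>prime q\<close> q
      by (intro dvd_mult2 int_dvd_int_iff[THEN iffD2] dvd_choose_prime) auto
    then show "[(\<Sum>k\<in>{..q} - {0, q}. Y k) = 0] (mod int q)"
      unfolding cong_0_iff by (rule dvd_sum)
  qed
  also have "Y 0 + Y q + 0 = f (g \<otimes> a [^] q) + (translate_sum G S ^^ q) f g"
    using insert.prems by (simp add: Y_def)
  also have "[\<dots> = f (g \<otimes> a [^] q) + (\<Sum>s\<in>S. f (g \<otimes> s [^] q))] (mod int q)"
    using insert by (intro cong_add cong_refl insert.IH) auto
  finally show ?case using insert by simp
qed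

lemma translate_sum_funpow_of_one:
  assumes "S \<subseteq> carrier G" and "\<And>h. h \<in> carrier G \<Longrightarrow> translate_sum G S f h = 1"
    and "g \<in> carrier G"
  shows "(translate_sum G S ^^ Suc m) f g = int (card S) ^ m"
  using assms(3)
proof (induction m arbitrary: g)
  case 0
  then show ?case using assms(2) by simp
next
  case (Suc m)
  have "(translate_sum G S ^^ Suc (Suc m)) f g = (\<Sum>s\<in>S. (translate_sum G S ^^ Suc m) f (g \<otimes> s))"
    by (simp add: translate_sum_def)
  also have "\<dots> = (\<Sum>s\<in>S. int (card S) ^ m)"
    using assms(1) Suc.prems by (intro sum.cong refl Suc.IH) auto
  finally show ?case by simp
qed

lemma sum_carrier_translate:
  assumes "h \<in> carrier G"
  shows "(\<Sum>g\<in>carrier G. f (g \<otimes> h)) = (\<Sum>g\<in>carrier G. f g)"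
  by (rule sum.reindex_bij_witness[of _ "\<lambda>g. g \<otimes> inv h" "\<lambda>g. g \<otimes> h"])
    (use assms in \<open>auto simp: m_assoc\<close>)

section \<open>Tilings by a prime number of translates\<close>

text \<open>Squaring the translating elements keeps a tiling a tiling when their number is odd.  The
  congruence modulo 2 only shows that every point is covered an odd number of times; that it is
  covered once follows because the multiplicities average to one over the finite group.\<close>

lemma tiling_sum_squares:
  assumes fin: "finite (carrier G)" and S: "S \<subseteq> carrier G" and "odd (card S)"
    and f: "\<And>g. f g \<ge> (0::int)"
    and tiling: "\<And>h. h \<in> carrier G \<Longrightarrow> translate_sum G S f h = 1"
    and g: "g \<in> carrier G"
  shows "(\<Sum>s\<in>S. f (g \<otimes> s [^] (2::nat))) = 1"
proof -
  define N where "N h = (\<Sum>s\<in>S. f (h \<otimes> s [^] (2::nat)))" for h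
  have finS: "finite S" using fin S by (rule finite_subset[rotated])
  have ge1: "N h \<ge> 1" if "h \<in> carrier G" for h
  proof -
    have "[int (card S) ^ 1 = N h] (mod int 2)"
      using translate_sum_funpow_prime_cong[OF two_is_prime_nat finS S that, of f]
        translate_sum_funpow_of_one[OF S tiling that, of 1]
      by (simp add: N_def numeral_2_eq_2)
    then have "odd (N h)"
      using \<open>odd (card S)\<close> by (simp add: cong_def) presburger
    moreover have "N h \<ge> 0" unfolding N_def by (intro sum_nonneg f)
    ultimately show ?thesis by (cases "N h = 0") auto
  qed
  have "(\<Sum>h\<in>carrier G. N h) = (\<Sum>s\<in>S. \<Sum>h\<in>carrier G. f (h \<otimes> s [^] (2::nat)))"
    unfolding N_def by (rule sum.swap)
  also have "\<dots> = (\<Sum>s\<in>S. \<Sum>h\<in>carrier G. f (h \<otimes> s))"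
  proof (rule sum.cong[OF refl])
    fix s assume "s \<in> S"
    then have "s \<in> carrier G" using S by blast
    then show "(\<Sum>h\<in>carrier G. f (h \<otimes> s [^] (2::nat))) = (\<Sum>h\<in>carrier G. f (h \<otimes> s))"
      by (simp add: sum_carrier_translate)
  qed
  also have "\<dots> = (\<Sum>h\<in>carrier G. translate_sum G S f h)"
    unfolding translate_sum_def by (rule sum.swap)
  also have "\<dots> = (\<Sum>h\<in>carrier G. 1)"
    by (intro sum.cong refl tiling)
  finally have "(\<Sum>h\<in>carrier G. N h - 1) = 0"
    by (simp add: sum_subtractf)
  then have "N g - 1 = 0"
  proof (rule sum_nonneg_0[OF fin, rotated])
    show "N h - 1 \<ge> 0" if "h \<in> carrier G" for h
      using ge1[OF that] by linarith
  qed (fact g)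
  then show ?thesis by (simp add: N_def)
qed

text \<open>The number of \<open>s \<in> S\<close> with \<open>g \<otimes> s [^] card S \<in> C\<close> is a multiple of the prime \<open>card S\<close>, so it
  is \<open>0\<close> or \<open>card S\<close>.\<close>

lemma tiling_prime_powers_eq:
  assumes "finite S" and S: "S \<subseteq> carrier G" and p: "prime (card S)"
    and tiling: "\<And>h. h \<in> carrier G \<Longrightarrow> translate_sum G S (indicator C) h = 1"
    and g: "g \<in> carrier G" and "s \<in> S" and "s' \<in> S"
    and "g \<otimes> s [^] card S \<in> C"
  shows "g \<otimes> s' [^] card S \<in> C"
proof (rule ccontr)
  assume notin: "g \<otimes> s' [^] card S \<notin> C"
  define A where "A = {x \<in> S. g \<otimes> x [^] card S \<in> C}"
  \<comment> \<open>Iterating \<open>card S\<close> times gives \<open>card S ^ (card S - 1)\<close>; the exponent is positive.\<close>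
  obtain m where m: "card S = Suc (Suc m)"
    using prime_ge_2_nat[OF p] by (metis add_2_eq_Suc le_Suc_ex)
  have "[int (card S) ^ Suc m = (\<Sum>x\<in>S. indicator C (g \<otimes> x [^] card S))] (mod int (card S))"
    using translate_sum_funpow_prime_cong[OF p assms(1) S g, of "indicator C"]
      translate_sum_funpow_of_one[OF S tiling g, of "Suc m"] m by simp
  moreover have "(\<Sum>x\<in>S. indicator C (g \<otimes> x [^] card S)) = int (card A)"
    using \<open>finite S\<close> by (simp add: A_def indicator_def of_bool_def sum.If_cases Int_def)
  ultimately have "int (card S) dvd int (card A)"
    by (metis cong_dvd_iff power_Suc dvd_triv_left)
  moreover have "A \<subset> S" and "s \<in> A"
    using notin assms unfolding A_def by auto
  then have "0 < card A" and "card A < card S"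
    using \<open>finite S\<close> by (auto simp: card_gt_0_iff psubset_card_mono finite_subset A_def)
  ultimately show False
    by (simp add: nat_dvd_not_less)
qed

text \<open>The elements whose power with exponent \<open>2 * card S\<close> is a period of \<open>C\<close> form a subgroup.  It
  contains \<open>S\<close>: by the previous lemma, the translates of a point by the \<open>card S\<close>-th powers of
  \<open>s\<close> and \<open>inv s\<close> are both in \<open>C\<close> or both outside, and they differ by that period.\<close>

lemma tiling_periodic:
  assumes "finite S" and S: "S \<subseteq> carrier G" and p: "prime (card S)"
    and inv_closed: "set_inv S = S" and gen: "generate G S = carrier G"
    and tiling: "\<And>h. h \<in> carrier G \<Longrightarrow> translate_sum G S (indicator C) h = 1"
    and "x \<in> carrier G" and g: "g \<in> carrier G"
  shows "g \<otimes> x [^] (2 * card S) \<in> C \<longleftrightarrow> g \<in> C"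
proof -
  define p where "p = card S"
  have inv_mem: "inv s \<in> S" if "s \<in> S" for s
    using that inv_closed by (auto simp: SET_INV_def)
  have powers_eq: "h \<otimes> s' [^] p \<in> C"
    if "h \<in> carrier G" "s \<in> S" "s' \<in> S" "h \<otimes> s [^] p \<in> C" for h s s'
    using that unfolding p_def
    by (rule tiling_prime_powers_eq[where s = s, rotated 4]) (fact assms(1) S p tiling)+
  have period: "h \<otimes> s [^] (2 * p) \<in> C \<longleftrightarrow> h \<in> C" if s: "s \<in> S" and h: "h \<in> carrier G" for h s
  proof -
    have sG: "s \<in> carrier G" using s S by blast
    have eq: "h \<otimes> s [^] p \<otimes> inv s [^] p = h" "h \<otimes> s [^] p \<otimes> s [^] p = h \<otimes> s [^] (2 * p)"
      using sG h by (simp_all add: m_assoc nat_pow_mult mult_2 nat_pow_inv)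
    have "h \<otimes> s [^] p \<in> carrier G" using sG h by simp
    then show ?thesis
      using powers_eq[of "h \<otimes> s [^] p" s "inv s"] powers_eq[of "h \<otimes> s [^] p" "inv s" s]
        inv_mem[OF s] s
      unfolding eq by blast
  qed
  have "x \<in> generate G S" using \<open>x \<in> carrier G\<close> gen by simp
  then show ?thesis
    using g unfolding p_def[symmetric]
  proof (induction x arbitrary: g rule: generate.induct)
    case (eng h1 h2)
    then have "h1 \<in> carrier G" "h2 \<in> carrier G" using gen by auto
    then have "g \<otimes> (h1 \<otimes> h2) [^] (2 * p) = g \<otimes> h1 [^] (2 * p) \<otimes> h2 [^] (2 * p)"
      using eng.prems by (simp add: nat_pow_distrib m_assoc)
    then show ?case
      using eng.IH \<open>h1 \<in> carrier G\<close> eng.prems by simp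
  qed (auto simp: period inv_mem)
qed

text \<open>If \<open>s\<close> and \<open>s'\<close> differ by a \<open>card S\<close>-th power, their squares differ by a period of \<open>C\<close>, so some
  point would be covered twice in the tiling by the squares unless \<open>s = s'\<close>.\<close>

lemma tiling_distinct_mod_powers:
  assumes fin: "finite (carrier G)" and S: "S \<subseteq> carrier G"
    and p: "prime (card S)" and "odd (card S)"
    and inv_closed: "set_inv S = S" and gen: "generate G S = carrier G"
    and tiling: "\<And>h. h \<in> carrier G \<Longrightarrow> \<exists>!s. s \<in> S \<and> h \<otimes> s \<in> C"
    and "s \<in> S" and "s' \<in> S" and "x \<in> carrier G" and s_eq: "s = s' \<otimes> x [^] card S"
  shows "s = s'"
proof (rule ccontr)
  assume "s \<noteq> s'"
  have finS: "finite S" using fin S by (rule finite_subset[rotated])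
  have one: "translate_sum G S (indicator C) h = 1" if h: "h \<in> carrier G" for h
  proof -
    obtain u where "{y \<in> S. h \<otimes> y \<in> C} = {u}"
      using tiling[OF h] by blast
    then show ?thesis
      using finS by (simp add: translate_sum_def indicator_def of_bool_def sum.If_cases Int_def)
  qed
  have sG: "s \<in> carrier G" "s' \<in> carrier G" using assms by auto
  obtain r where r: "r \<in> S" "\<one> \<otimes> r \<in> C" using tiling[OF one_closed] by blast
  \<comment> \<open>Any member \<open>r\<close> of \<open>C\<close> will do; \<open>g\<close> is the point that \<open>s [^] 2\<close> moves to it.\<close>
  define g where "g = r \<otimes> inv (s [^] (2::nat))"
  have rG: "r \<in> carrier G" using r S by blast
  have g: "g \<in> carrier G" using sG rG by (simp add: g_def)
  have sC: "g \<otimes> s [^] (2::nat) \<in> C"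
    using r rG sG by (simp add: g_def m_assoc)
  have "s [^] (2::nat) = s' [^] (2::nat) \<otimes> x [^] (2 * card S)"
    unfolding s_eq using sG \<open>x \<in> carrier G\<close>
    by (simp add: nat_pow_distrib nat_pow_pow mult.commute)
  then have "g \<otimes> s [^] (2::nat) = g \<otimes> s' [^] (2::nat) \<otimes> x [^] (2 * card S)"
    using g sG \<open>x \<in> carrier G\<close> by (simp add: m_assoc)
  then have s'C: "g \<otimes> s' [^] (2::nat) \<in> C"
    using tiling_periodic[OF finS S p inv_closed gen one \<open>x \<in> carrier G\<close>,
        of "g \<otimes> s' [^] (2::nat)"] sC g sG by simp
  have "(\<Sum>y\<in>{s, s'}. indicator C (g \<otimes> y [^] (2::nat))) \<le>
      (\<Sum>y\<in>S. indicator C (g \<otimes> y [^] (2::nat)) :: int)"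
    using finS assms by (intro sum_mono2) auto
  also have "\<dots> = 1"
    by (rule tiling_sum_squares[OF fin S \<open>odd (card S)\<close> _ one g]) auto
  finally show False
    using \<open>s \<noteq> s'\<close> sC s'C by simp
qed

end

section \<open>Cayley graphs of products of cyclic groups\<close>

text \<open>The out-neighbours of \<open>v\<close> are the \<open>s \<otimes> v\<close> with \<open>s \<in> S\<close>, each for exactly one \<open>s\<close>.\<close>

lemma total_perfect_code_cayley_graph_iff:
  assumes "group G" and "S \<subseteq> carrier G"
  shows "total_perfect_code (with_proj (cayley_graph G S)) C \<longleftrightarrow>
    C \<subseteq> carrier G \<and> (\<forall>v\<in>carrier G. \<exists>!s. s \<in> S \<and> s \<otimes>\<^bsub>G\<^esub> v \<in> C)"
proof -
  interpret group G by fact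
  have arc: "v \<rightarrow>\<^bsub>with_proj (cayley_graph G S)\<^esub> c \<longleftrightarrow>
      v \<in> carrier G \<and> c \<in> carrier G \<and> c \<otimes>\<^bsub>G\<^esub> inv\<^bsub>G\<^esub> v \<in> S" for v c
    by (auto simp: cayley_graph_def arcs_ends_def arc_to_ends_def)
  have "(\<exists>!c. c \<in> C \<and> c \<otimes>\<^bsub>G\<^esub> inv\<^bsub>G\<^esub> v \<in> S) \<longleftrightarrow> (\<exists>!s. s \<in> S \<and> s \<otimes>\<^bsub>G\<^esub> v \<in> C)"
    if "C \<subseteq> carrier G" and v: "v \<in> carrier G" for v
  proof -
    have "bij_betw (\<lambda>s. s \<otimes>\<^bsub>G\<^esub> v) {s \<in> S. s \<otimes>\<^bsub>G\<^esub> v \<in> C} {c \<in> C. c \<otimes>\<^bsub>G\<^esub> inv\<^bsub>G\<^esub> v \<in> S}"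
      using that assms(2)
      by (intro bij_betw_byWitness[where f' = "\<lambda>c. c \<otimes>\<^bsub>G\<^esub> inv\<^bsub>G\<^esub> v"])
        (auto simp: m_assoc subset_iff)
    then have "card {s \<in> S. s \<otimes>\<^bsub>G\<^esub> v \<in> C} = card {c \<in> C. c \<otimes>\<^bsub>G\<^esub> inv\<^bsub>G\<^esub> v \<in> S}"
      by (rule bij_betw_same_card)
    moreover have "(\<exists>!x. P x) \<longleftrightarrow> card {x. P x} = 1" for P :: "'a \<Rightarrow> bool"
      unfolding One_nat_def card_1_singleton_iff by (auto simp: set_eq_iff)
    ultimately show ?thesis by simp
  qed
  moreover have "(\<exists>!c. c \<in> C \<and> v \<rightarrow>\<^bsub>with_proj (cayley_graph G S)\<^esub> c) \<longleftrightarrow>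
      (\<exists>!c. c \<in> C \<and> c \<otimes>\<^bsub>G\<^esub> inv\<^bsub>G\<^esub> v \<in> S)" if "C \<subseteq> carrier G" "v \<in> carrier G" for v
    unfolding arc using that by (intro arg_cong[where f = Ex1]) auto
  moreover have "verts (with_proj (cayley_graph G S)) = carrier G"
    by (simp add: cayley_graph_def)
  ultimately show ?thesis
    unfolding total_perfect_code_def by (simp cong: conj_cong)
qed

text \<open>Additively, the equation \<open>s = s' + p x\<close> is solved coordinate by coordinate: by division where \<open>p\<close>
  divides the modulus, and by inverting \<open>p\<close> elsewhere.\<close>

lemma product_integer_mod_power_diff:
  fixes n :: "nat \<Rightarrow> nat" and I :: "nat set"
  defines "G \<equiv> product_group I (\<lambda>i. integer_mod_group (n i))"
  assumes "prime p" and s: "s \<in> carrier G" and s': "s' \<in> carrier G" and "\<And>i. i \<in> I \<Longrightarrow> n i > 0"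
    and only: "\<And>i. i \<in> I \<Longrightarrow> p dvd n i \<Longrightarrow> [s i = s' i] (mod int p)"
  shows "\<exists>x\<in>carrier G. s = s' \<otimes>\<^bsub>G\<^esub> x [^]\<^bsub>G\<^esub> p"
proof -
  have "\<exists>y. [s i - s' i = int p * y] (mod int (n i))" if i: "i \<in> I" for i
  proof (cases "p dvd n i")
    case True
    then obtain y where "s i - s' i = int p * y"
      using only[OF i] by (auto simp: cong_iff_dvd_diff)
    then show ?thesis by (metis cong_refl)
  next
    case False
    then have "coprime (int p) (int (n i))"
      using \<open>prime p\<close> prime_imp_coprime by (metis coprime_int_iff)
    then obtain z where "[int p * z = 1] (mod int (n i))"
      using cong_solve_coprime_int by blast
    then have "[int p * z * (s i - s' i) = 1 * (s i - s' i)] (mod int (n i))"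
      by (rule cong_scalar_right)
    then show ?thesis
      by (intro exI[of _ "z * (s i - s' i)"]) (simp add: cong_sym mult.assoc)
  qed
  then obtain y where y: "\<And>i. i \<in> I \<Longrightarrow> [s i - s' i = int p * y i] (mod int (n i))"
    by metis
  define x where "x = (\<lambda>i\<in>I. y i mod int (n i))"
  have x: "x \<in> carrier G"
    using assms(5) by (auto simp: G_def x_def carrier_integer_mod_group)
  have pow: "x [^]\<^bsub>G\<^esub> m = (\<lambda>i\<in>I. (int m * x i) mod int (n i))" for m :: nat
    by (induction m) (auto simp: G_def fun_eq_iff mod_simps algebra_simps)
  have "s i = (s' \<otimes>\<^bsub>G\<^esub> x [^]\<^bsub>G\<^esub> p) i" for i
  proof (cases "i \<in> I")
    case True
    have "s i \<in> {0..<int (n i)}"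
      using s True assms(5)[OF True] by (auto simp: G_def carrier_integer_mod_group PiE_iff)
    then have "s i = s i mod int (n i)" by simp
    also have "[s i = s' i + int p * y i] (mod int (n i))"
      using cong_add[OF cong_refl[of "s' i"] y[OF True]] by simp
    then have "s i mod int (n i) = (s' i + int p * y i) mod int (n i)"
      by (simp add: cong_def)
    also have "\<dots> = (s' \<otimes>\<^bsub>G\<^esub> x [^]\<^bsub>G\<^esub> p) i"
      using True unfolding pow by (simp add: G_def x_def mod_simps)
    finally show ?thesis .
  next
    case False
    then show ?thesis using s by (auto simp: G_def PiE_iff extensional_def)
  qed
  then show ?thesis using x by blast
qed

lemma distinct_residues_complete:
  assumes "finite S" and "card S = p" and "p > 0"
    and "\<And>s s'. s \<in> S \<Longrightarrow> s' \<in> S \<Longrightarrow> [f s = f s'] (mod int p) \<Longrightarrow> s = s'"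
  shows "\<exists>!s. s \<in> S \<and> [f s = r] (mod int p)"
proof -
  have inj: "inj_on (\<lambda>s. f s mod int p) S"
    using assms(4) by (auto simp: inj_on_def cong_def)
  have "(\<lambda>s. f s mod int p) ` S = {0..<int p}"
    using assms(1-3) card_image[OF inj] by (intro card_subset_eq) auto
  moreover have "r mod int p \<in> {0..<int p}" using \<open>p > 0\<close> by simp
  ultimately obtain s where "s \<in> S" "f s mod int p = r mod int p"
    by (metis (no_types, lifting) imageE)
  then show ?thesis
    using assms(4) by (intro ex1I[of _ s]) (auto simp: cong_def)
qed

theorem theorem4p7:
  fixes n :: "nat \<Rightarrow> nat" and d p t :: nat and S :: "(nat \<Rightarrow> int) set"
  defines "G \<equiv> product_group {1..d} (\<lambda>i. integer_mod_group (n i))"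
  assumes "\<And>i. i \<in> {1..d} \<Longrightarrow> n i \<ge> 2"
    and "S \<subseteq> carrier G - {\<one>\<^bsub>G\<^esub>}"
    and "set_inv\<^bsub>G\<^esub> S = S"
    and "generate G S = carrier G"
    and "card S = p" and "prime p" and "odd p"
    and "t \<in> {1..d}" and "p dvd n t"
    and "\<And>i. i \<in> {1..d} \<Longrightarrow> p dvd n i \<Longrightarrow> i = t"
  shows "(\<exists>C. total_perfect_code (with_proj (cayley_graph G S)) C) \<longleftrightarrow>
         (\<forall>s \<in> S. \<forall>s' \<in> S. s \<noteq> s' \<longrightarrow> \<not> [s t = s' t] (mod int p))"
proof -
  have "group G" unfolding G_def by simp
  moreover have "x \<otimes>\<^bsub>G\<^esub> y = y \<otimes>\<^bsub>G\<^esub> x" for x y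
    unfolding G_def by (simp add: add.commute)
  ultimately have "comm_group G" by (intro group.group_comm_groupI)
  then interpret comm_group G .
  have n_pos: "n i > 0" if "i \<in> {1..d}" for i
    using assms(2)[OF that] by simp
  have fin: "finite (carrier G)"
    using n_pos by (auto simp: G_def carrier_integer_mod_group intro!: finite_PiE)
  have S: "S \<subseteq> carrier G" using assms(3) by blast
  have code_iff: "total_perfect_code (with_proj (cayley_graph G S)) C \<longleftrightarrow>
      C \<subseteq> carrier G \<and> (\<forall>v\<in>carrier G. \<exists>!s. s \<in> S \<and> s \<otimes>\<^bsub>G\<^esub> v \<in> C)" for C
    by (rule total_perfect_code_cayley_graph_iff[OF \<open>group G\<close> S])
  show ?thesis
  proof
    assume "\<exists>C. total_perfect_code (with_proj (cayley_graph G S)) C"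
    then obtain C where "total_perfect_code (with_proj (cayley_graph G S)) C" ..
    then have C: "\<And>v. v \<in> carrier G \<Longrightarrow> \<exists>!s. s \<in> S \<and> s \<otimes>\<^bsub>G\<^esub> v \<in> C"
      unfolding code_iff by simp
    have tiling: "\<exists>!s. s \<in> S \<and> v \<otimes>\<^bsub>G\<^esub> s \<in> C" if "v \<in> carrier G" for v
    proof -
      have "v \<otimes>\<^bsub>G\<^esub> s = s \<otimes>\<^bsub>G\<^esub> v" if "s \<in> S" for s
        using \<open>v \<in> carrier G\<close> that S by (intro m_comm) auto
      then have "(s \<in> S \<and> v \<otimes>\<^bsub>G\<^esub> s \<in> C) = (s \<in> S \<and> s \<otimes>\<^bsub>G\<^esub> v \<in> C)" for s
        by (metis (no_types))
      then show ?thesis using C[OF that] by (simp only:)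
    qed
    show "\<forall>s \<in> S. \<forall>s' \<in> S. s \<noteq> s' \<longrightarrow> \<not> [s t = s' t] (mod int p)"
    proof (intro ballI impI notI)
      fix s s' assume s: "s \<in> S" "s' \<in> S" and "s \<noteq> s'" and "[s t = s' t] (mod int p)"
      then obtain x where "x \<in> carrier G" "s = s' \<otimes>\<^bsub>G\<^esub> x [^]\<^bsub>G\<^esub> p"
        using product_integer_mod_power_diff[of p s "{1..d}" n s'] S assms(7,11) n_pos
        unfolding G_def by blast
      with s have "s = s'"
        using tiling_distinct_mod_powers[OF fin S _ _ assms(4,5), of C s s' x]
          tiling assms(6-8) \<open>x \<in> carrier G\<close> by simp
      with \<open>s \<noteq> s'\<close> show False ..
    qed
  next
    assume distinct: "\<forall>s \<in> S. \<forall>s' \<in> S. s \<noteq> s' \<longrightarrow> \<not> [s t = s' t] (mod int p)"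
    define C where "C = {c \<in> carrier G. int p dvd c t}"
    have "finite S" using S fin by (rule finite_subset)
    have "\<exists>!s. s \<in> S \<and> s \<otimes>\<^bsub>G\<^esub> v \<in> C" if v: "v \<in> carrier G" for v
    proof -
      have "s \<otimes>\<^bsub>G\<^esub> v \<in> C \<longleftrightarrow> [s t = - v t] (mod int p)" if "s \<in> S" for s
      proof -
        have "s \<otimes>\<^bsub>G\<^esub> v \<in> carrier G" using that S v by blast
        moreover have "(s \<otimes>\<^bsub>G\<^esub> v) t = (s t + v t) mod int (n t)"
          using assms(9) by (simp add: G_def)
        moreover have "int p dvd (s t + v t) mod int (n t) \<longleftrightarrow> int p dvd s t + v t"
          using assms(10) by (simp add: dvd_mod_iff)
        ultimately show ?thesis by (simp add: C_def cong_iff_dvd_diff)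
      qed
      then have "(s \<in> S \<and> s \<otimes>\<^bsub>G\<^esub> v \<in> C) = (s \<in> S \<and> [s t = - v t] (mod int p))" for s
        by blast
      moreover have "\<exists>!s. s \<in> S \<and> [s t = - v t] (mod int p)"
        using distinct \<open>finite S\<close> assms(6) prime_gt_0_nat[OF assms(7)]
        by (intro distinct_residues_complete) auto
      ultimately show ?thesis by simp
    qed
    moreover have "C \<subseteq> carrier G" unfolding C_def by simp
    ultimately have "total_perfect_code (with_proj (cayley_graph G S)) C"
      unfolding code_iff by simp
    then show "\<exists>C. total_perfect_code (with_proj (cayley_graph G S)) C" ..
  qed
qed

end
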